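(* Let $X$ be an exterior space. Suppose that for every $E\in\varepsilon(X)$ there is $E'\in\varepsilon(X)$ such that $E'\subset E$ and the image of the induced map $\pi_0(E')\to\pi_0(E)$ is finite. Then: (i) $L(\check C_0(X))$ is compact. (ii) Denote by $\eta_{0,E}(\check\pi_0(X))$ the image of $\eta_{0,E}\colon\check\pi_0(X)\to\pi_0(E)$. If for every $E\in\varepsilon(X)$ the set $X\setminus\bigl(\bigcup_{C\in\eta_{0,E}(\check\pi_0(X))}C\bigr)$ is compact, then $\check C_0(X)$ is compact.
   Context: Exterior spaces: an exterior space is a topological space $X$ together with a nonempty family $\varepsilon(X)$ of open subsets (an externology; its members are called exterior open subsets) closed under finite intersections and such that if $E\in\varepsilon(X)$, $U$ is open and $E\subset U$, then $U\in\varepsilon(X)$. Limit and end spaces: for a space $Y$, $\pi_0(Y)$ is the set of path-components with the quotient topology of $q_0\colon Y\to\pi_0(Y)$. $L(X)=\bigcap_{E\in\varepsilon(X)}E$ (subspace topology); $\check\pi_0(X)=\lim_{E\in\varepsilon(X)}\pi_0(E)$ (inverse limit topology), with projections $\eta_{0,E}\colon\check\pi_0(X)\to\pi_0(E)$; $e_0\colon L(X)\to\check\pi_0(X)$ sends $x$ to the family of path-components of $x$ in the sets $E$. Completion: $\check C_0(X)$ has underlying set the push-out $X\cup_{L(X)}\check\pi_0(X)$ of the inclusion $L(X)\to X$ and $e_0$, with canonical maps $p_0\colon X\to\check C_0(X)$, $\operatorname{in}_0\colon\check\pi_0(X)\to\check C_0(X)$. A subset $W$ is open iff (i) $p_0^{-1}(W)$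 and $\operatorname{in}_0^{-1}(W)$ are open, and (ii) for each $a\in\operatorname{in}_0^{-1}(W)$ there are $E\in\varepsilon(X)$ and an open $G\subset\pi_0(E)$ with $a\in\eta_{0,E}^{-1}(G)\subset\operatorname{in}_0^{-1}(W)$ and $q_0^{-1}(G)\subset p_0^{-1}(W)$. Its externology is $\{W_0(E): E\in\varepsilon(X)\}$ with $W_0(E)=p_0(E)\cup\operatorname{in}_0(\check\pi_0(X))$, and $L(\check C_0(X))=\bigcap_E W_0(E)$ with the subspace topology. *)

theory Defs
  imports "HOL-Analysis.Analysis"
begin

section \<open>Exterior spaces\<close>

definition exterior_space :: "'a topology \<Rightarrow> 'a set set \<Rightarrow> bool" where
  "exterior_space X \<epsilon> \<longleftrightarrow>
     \<epsilon> \<noteq> {} \<and>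
     (\<forall>E\<in>\<epsilon>. openin X E) \<and>
     (\<forall>E\<in>\<epsilon>. \<forall>F\<in>\<epsilon>. E \<inter> F \<in> \<epsilon>) \<and>
     (\<forall>E\<in>\<epsilon>. \<forall>U. openin X U \<longrightarrow> E \<subseteq> U \<longrightarrow> U \<in> \<epsilon>)"

definition limit_space :: "'a topology \<Rightarrow> 'a set set \<Rightarrow> 'a topology" where
  "limit_space X \<epsilon> = subtopology X (\<Inter>\<epsilon>)"

section \<open>The space of path-components\<close>

abbreviation q0 :: "'a topology \<Rightarrow> 'a \<Rightarrow> 'a set" where
  "q0 Y x \<equiv> path_component_of_set Y x"

definition pi0_space :: "'a topology \<Rightarrow> 'a set topology" where
  "pi0_space Y = topology (\<lambda>G. G \<subseteq> path_components_of Y \<and>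
                               openin Y {x \<in> topspace Y. q0 Y x \<in> G})"

text \<open>The map induced on path-components by a continuous map \<open>f\<close> into \<open>Z\<close>; the description is
  proper when \<open>C\<close> is a path-component of the domain of \<open>f\<close>.\<close>

definition pi0_map :: "'a topology \<Rightarrow> ('b \<Rightarrow> 'a) \<Rightarrow> 'b set \<Rightarrow> 'a set" where
  "pi0_map Z f C = (THE D. D \<in> path_components_of Z \<and> f ` C \<subseteq> D)"

lemma openin_pi0_space:
  "openin (pi0_space Y) G \<longleftrightarrow>
     G \<subseteq> path_components_of Y \<and> openin Y {x \<in> topspace Y. q0 Y x \<in> G}"
proof -
  have "istopology (\<lambda>G. G \<subseteq> path_components_of Y \<and> openin Y {x \<in> topspace Y. q0 Y x \<in> G})"
    unfolding istopology_def
  proof (intro conjI allI impI)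
    fix S T
    assume S: "S \<subseteq> path_components_of Y \<and> openin Y {x \<in> topspace Y. q0 Y x \<in> S}"
      and T: "T \<subseteq> path_components_of Y \<and> openin Y {x \<in> topspace Y. q0 Y x \<in> T}"
    show "S \<inter> T \<subseteq> path_components_of Y" using S by blast
    have "{x \<in> topspace Y. q0 Y x \<in> S \<inter> T} =
            {x \<in> topspace Y. q0 Y x \<in> S} \<inter> {x \<in> topspace Y. q0 Y x \<in> T}" by blast
    then show "openin Y {x \<in> topspace Y. q0 Y x \<in> S \<inter> T}" using S T by auto
  next
    fix \<K>
    assume K: "\<forall>S\<in>\<K>. S \<subseteq> path_components_of Y \<and> openin Y {x \<in> topspace Y. q0 Y x \<in> S}"
    show "\<Union>\<K> \<subseteq> path_components_of Y" using K by blast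
    have "{x \<in> topspace Y. q0 Y x \<in> \<Union>\<K>} = (\<Union>S\<in>\<K>. {x \<in> topspace Y. q0 Y x \<in> S})" by blast
    then show "openin Y {x \<in> topspace Y. q0 Y x \<in> \<Union>\<K>}" using K by auto
  qed
  then show ?thesis
    by (simp add: pi0_space_def)
qed

lemma topspace_pi0_space [simp]: "topspace (pi0_space Y) = path_components_of Y"
proof
  show "topspace (pi0_space Y) \<subseteq> path_components_of Y"
    by (meson openin_pi0_space openin_topspace)
  have "{x \<in> topspace Y. q0 Y x \<in> path_components_of Y} = topspace Y"
    by (auto simp: path_components_of_def)
  then have "openin (pi0_space Y) (path_components_of Y)"
    by (simp add: openin_pi0_space)
  then show "path_components_of Y \<subseteq> topspace (pi0_space Y)"
    by (rule openin_subset)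
qed

lemma quotient_map_q0: "quotient_map Y (pi0_space Y) (q0 Y)"
  by (auto simp: quotient_map_def openin_pi0_space path_components_of_def)

lemma pi0_map_q0:
  assumes f: "continuous_map Y Z f" and x: "x \<in> topspace Y"
  shows "pi0_map Z f (q0 Y x) = q0 Z (f x)"
  unfolding pi0_map_def
proof (rule the_equality)
  have fx: "f x \<in> topspace Z"
    using f x by (auto simp: continuous_map_def)
  have xq: "x \<in> q0 Y x" using x by (simp add: path_component_of_refl)
  have "path_connectedin Z (f ` q0 Y x)"
    by (rule path_connectedin_continuous_map_image[OF f path_connectedin_path_component_of])
  then have "f ` q0 Y x \<subseteq> q0 Z (f x)"
    by (rule path_component_of_maximal) (rule imageI, rule xq)
  with fx show "q0 Z (f x) \<in> path_components_of Z \<and> f ` q0 Y x \<subseteq> q0 Z (f x)"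
    by (auto simp: path_components_of_def)
  fix D assume D: "D \<in> path_components_of Z \<and> f ` q0 Y x \<subseteq> D"
  then obtain z where z: "D = q0 Z z" by (auto simp: path_components_of_def)
  have "f x \<in> D" using D imageI[OF xq, of f] by (rule_tac subsetD, rule_tac conjunct2)
  then have "path_component_of Z z (f x)" unfolding z by (rule CollectD)
  then show "D = q0 Z (f x)"
    unfolding z by (metis path_component_of_equiv)
qed

lemma continuous_map_subtopology_id:
  "F \<subseteq> E \<Longrightarrow> continuous_map (subtopology X F) (subtopology X E) id"
  by (rule continuous_map_from_subtopology_mono[OF continuous_map_id])

lemma q0_subtopology_mono:
  assumes "F \<subseteq> E" "x \<in> topspace (subtopology X F)"
  shows "pi0_map (subtopology X E) id (q0 (subtopology X F) x) = q0 (subtopology X E) x"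
  using pi0_map_q0[OF continuous_map_subtopology_id[OF assms(1)] assms(2)] by simp

section \<open>The end space\<close>

text \<open>The inverse limit of the path-component spaces of the exterior open sets, directed by
  inclusion. Points are compatible families, extensional outside \<open>\<epsilon>\<close>.\<close>

definition end_space :: "'a topology \<Rightarrow> 'a set set \<Rightarrow> ('a set \<Rightarrow> 'a set) topology" where
  "end_space X \<epsilon> = subtopology (product_topology (\<lambda>E. pi0_space (subtopology X E)) \<epsilon>)
     {a. \<forall>E\<in>\<epsilon>. \<forall>E'\<in>\<epsilon>. E' \<subseteq> E \<longrightarrow> pi0_map (subtopology X E) id (a E') = a E}"

definition eta0 :: "'a set \<Rightarrow> ('a set \<Rightarrow> 'a set) \<Rightarrow> 'a set" where
  "eta0 E a = a E"

definition e0 :: "'a topology \<Rightarrow> 'a set set \<Rightarrow> 'a \<Rightarrow> ('a set \<Rightarrow> 'a set)" where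
  "e0 X \<epsilon> x = (\<lambda>E\<in>\<epsilon>. q0 (subtopology X E) x)"

lemma continuous_map_eta0:
  assumes "E \<in> \<epsilon>"
  shows "continuous_map (end_space X \<epsilon>) (pi0_space (subtopology X E)) (eta0 E)"
proof -
  have eq: "eta0 E = (\<lambda>a. a E)" by (simp add: fun_eq_iff eta0_def)
  show ?thesis
    unfolding end_space_def eq
    by (rule continuous_map_from_subtopology, rule continuous_map_product_projection, rule assms)
qed

lemma e0_in_end_space:
  assumes ext: "exterior_space X \<epsilon>" and x: "x \<in> topspace (limit_space X \<epsilon>)"
  shows "e0 X \<epsilon> x \<in> topspace (end_space X \<epsilon>)"
proof -
  have xE: "x \<in> topspace (subtopology X E)" if "E \<in> \<epsilon>" for E
    using that x by (auto simp: limit_space_def)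
  have "pi0_map (subtopology X E) id (q0 (subtopology X E') x) = q0 (subtopology X E) x"
    if "E' \<in> \<epsilon>" "E' \<subseteq> E" for E E'
    using that xE by (intro q0_subtopology_mono)
  then have "pi0_map (subtopology X E) id (e0 X \<epsilon> x E') = e0 X \<epsilon> x E"
    if "E \<in> \<epsilon>" "E' \<in> \<epsilon>" "E' \<subseteq> E" for E E'
    using that by (simp add: e0_def)
  moreover have "e0 X \<epsilon> x \<in> (\<Pi>\<^sub>E E\<in>\<epsilon>. path_components_of (subtopology X E))"
    unfolding e0_def path_components_of_def by (intro restrict_PiE_iff[THEN iffD2] ballI imageI xE)
  ultimately show ?thesis
    unfolding end_space_def topspace_subtopology topspace_product_topology
    by (simp add: o_def)
qed

section \<open>The completion\<close>

text \<open>The push-out of sets of \<open>f\<close> from \<open>A\<close> to \<open>B\<close> and \<open>g\<close> from \<open>A\<close> to \<open>C\<close> is the quotient of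
  the disjoint union of \<open>B\<close> and \<open>C\<close> by the equivalence relation generated by \<open>f z \<sim> g z\<close>
  for \<open>z\<close> in \<open>A\<close>.\<close>

definition pushout_rel ::
    "'z set \<Rightarrow> 'b set \<Rightarrow> 'c set \<Rightarrow> ('z \<Rightarrow> 'b) \<Rightarrow> ('z \<Rightarrow> 'c) \<Rightarrow> (('b + 'c) \<times> ('b + 'c)) set" where
  "pushout_rel A B C f g =
     {(u, v). u \<in> B <+> C \<and> v \<in> B <+> C \<and>
              equivclp (\<lambda>s t. \<exists>z\<in>A. s = Inl (f z) \<and> t = Inr (g z)) u v}"

lemma equiv_pushout_rel: "equiv (B <+> C) (pushout_rel A B C f g)"
proof (rule equivI)
  show "refl_on (B <+> C) (pushout_rel A B C f g)"
    by (rule refl_onI) (simp add: pushout_rel_def)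
  show "sym (pushout_rel A B C f g)"
  proof (rule symI)
    fix u v assume "(u, v) \<in> pushout_rel A B C f g"
    then show "(v, u) \<in> pushout_rel A B C f g"
      unfolding pushout_rel_def mem_Collect_eq case_prod_conv
      by (elim conjE, intro conjI) (assumption, assumption, erule equivclp_sym)
  qed
  show "trans (pushout_rel A B C f g)"
  proof (rule transI)
    fix u v w assume "(u, v) \<in> pushout_rel A B C f g" "(v, w) \<in> pushout_rel A B C f g"
    then show "(u, w) \<in> pushout_rel A B C f g"
      unfolding pushout_rel_def mem_Collect_eq case_prod_conv
      by (elim conjE, intro conjI) (assumption, assumption, erule (1) equivclp_trans)
  qed
  show "pushout_rel A B C f g \<subseteq> (B <+> C) \<times> (B <+> C)"
    unfolding pushout_rel_def by blast
qed

definition completion_rel ::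
    "'a topology \<Rightarrow> 'a set set \<Rightarrow> (('a + ('a set \<Rightarrow> 'a set)) \<times> ('a + ('a set \<Rightarrow> 'a set))) set" where
  "completion_rel X \<epsilon> =
     pushout_rel (topspace (limit_space X \<epsilon>)) (topspace X) (topspace (end_space X \<epsilon>))
       (\<lambda>x. x) (e0 X \<epsilon>)"

definition completion_set ::
    "'a topology \<Rightarrow> 'a set set \<Rightarrow> ('a + ('a set \<Rightarrow> 'a set)) set set" where
  "completion_set X \<epsilon> = (topspace X <+> topspace (end_space X \<epsilon>)) // completion_rel X \<epsilon>"

definition p0 :: "'a topology \<Rightarrow> 'a set set \<Rightarrow> 'a \<Rightarrow> ('a + ('a set \<Rightarrow> 'a set)) set" where
  "p0 X \<epsilon> x = completion_rel X \<epsilon> `` {Inl x}"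

definition in0 ::
    "'a topology \<Rightarrow> 'a set set \<Rightarrow> ('a set \<Rightarrow> 'a set) \<Rightarrow> ('a + ('a set \<Rightarrow> 'a set)) set" where
  "in0 X \<epsilon> a = completion_rel X \<epsilon> `` {Inr a}"

definition p0_preimage ::
    "'a topology \<Rightarrow> 'a set set \<Rightarrow> ('a + ('a set \<Rightarrow> 'a set)) set set \<Rightarrow> 'a set" where
  "p0_preimage X \<epsilon> W = {x \<in> topspace X. p0 X \<epsilon> x \<in> W}"

definition in0_preimage ::
    "'a topology \<Rightarrow> 'a set set \<Rightarrow> ('a + ('a set \<Rightarrow> 'a set)) set set \<Rightarrow> ('a set \<Rightarrow> 'a set) set" where
  "in0_preimage X \<epsilon> W = {a \<in> topspace (end_space X \<epsilon>). in0 X \<epsilon> a \<in> W}"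

definition completion_open ::
    "'a topology \<Rightarrow> 'a set set \<Rightarrow> ('a + ('a set \<Rightarrow> 'a set)) set set \<Rightarrow> bool" where
  "completion_open X \<epsilon> W \<longleftrightarrow>
     W \<subseteq> completion_set X \<epsilon> \<and>
     openin X (p0_preimage X \<epsilon> W) \<and>
     openin (end_space X \<epsilon>) (in0_preimage X \<epsilon> W) \<and>
     (\<forall>a \<in> in0_preimage X \<epsilon> W.
        \<exists>E\<in>\<epsilon>. \<exists>G. openin (pi0_space (subtopology X E)) G \<and>
          a \<in> {b \<in> topspace (end_space X \<epsilon>). eta0 E b \<in> G} \<and>
          {b \<in> topspace (end_space X \<epsilon>). eta0 E b \<in> G} \<subseteq> in0_preimage X \<epsilon> W \<and>
          {x \<in> topspace (subtopology X E). q0 (subtopology X E) x \<in> G} \<subseteq> p0_preimage X \<epsilon> W)"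

definition end_completion :: "'a topology \<Rightarrow> 'a set set \<Rightarrow> ('a + ('a set \<Rightarrow> 'a set)) set topology" where
  "end_completion X \<epsilon> = topology (completion_open X \<epsilon>)"

definition W0 :: "'a topology \<Rightarrow> 'a set set \<Rightarrow> 'a set \<Rightarrow> ('a + ('a set \<Rightarrow> 'a set)) set set" where
  "W0 X \<epsilon> E = p0 X \<epsilon> ` E \<union> in0 X \<epsilon> ` topspace (end_space X \<epsilon>)"

definition completion_externology ::
    "'a topology \<Rightarrow> 'a set set \<Rightarrow> ('a + ('a set \<Rightarrow> 'a set)) set set set" where
  "completion_externology X \<epsilon> = W0 X \<epsilon> ` \<epsilon>"

subsection \<open>The topology of the completion is well defined\<close>

lemma eta0_compat:
  assumes "a \<in> topspace (end_space X \<epsilon>)" "E \<in> \<epsilon>" "F \<in> \<epsilon>" "F \<subseteq> E"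
  shows "pi0_map (subtopology X E) id (eta0 F a) = eta0 E a"
  using assms by (auto simp: end_space_def eta0_def)

lemma eta0_in_path_components:
  assumes "a \<in> topspace (end_space X \<epsilon>)" "E \<in> \<epsilon>"
  shows "eta0 E a \<in> path_components_of (subtopology X E)"
  using assms by (auto simp: end_space_def eta0_def)

lemma openin_pi0_map_preimage:
  assumes f: "continuous_map Y Z f" and G: "openin (pi0_space Z) G"
  shows "openin (pi0_space Y) {C \<in> path_components_of Y. pi0_map Z f C \<in> G}"
proof -
  have "{x \<in> topspace Y. q0 Y x \<in> {C \<in> path_components_of Y. pi0_map Z f C \<in> G}}
        = {x \<in> topspace Y. f x \<in> {z \<in> topspace Z. q0 Z z \<in> G}}"
    using pi0_map_q0[OF f] f
    by (auto simp: path_components_of_def continuous_map_def)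
  moreover have "openin Y {x \<in> topspace Y. f x \<in> {z \<in> topspace Z. q0 Z z \<in> G}}"
    using f G by (intro openin_continuous_map_preimage) (auto simp: openin_pi0_space)
  ultimately show ?thesis
    by (simp add: openin_pi0_space)
qed

lemma completion_openE:
  assumes "completion_open X \<epsilon> W" "a \<in> in0_preimage X \<epsilon> W"
  obtains E G where "E \<in> \<epsilon>" "openin (pi0_space (subtopology X E)) G"
    "a \<in> {b \<in> topspace (end_space X \<epsilon>). eta0 E b \<in> G}"
    "{b \<in> topspace (end_space X \<epsilon>). eta0 E b \<in> G} \<subseteq> in0_preimage X \<epsilon> W"
    "{x \<in> topspace (subtopology X E). q0 (subtopology X E) x \<in> G} \<subseteq> p0_preimage X \<epsilon> W"
proof -
  have "\<exists>E\<in>\<epsilon>. \<exists>G. openin (pi0_space (subtopology X E)) G \<and>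
          a \<in> {b \<in> topspace (end_space X \<epsilon>). eta0 E b \<in> G} \<and>
          {b \<in> topspace (end_space X \<epsilon>). eta0 E b \<in> G} \<subseteq> in0_preimage X \<epsilon> W \<and>
          {x \<in> topspace (subtopology X E). q0 (subtopology X E) x \<in> G} \<subseteq> p0_preimage X \<epsilon> W"
    using assms(1) unfolding completion_open_def by (elim conjE) (erule bspec, rule assms(2))
  then show thesis
    by (elim bexE exE conjE) (rule that)
qed

lemma istopology_completion:
  assumes ext: "exterior_space X \<epsilon>"
  shows "istopology (completion_open X \<epsilon>)"
  unfolding istopology_def
proof (intro conjI allI impI)
  fix S T assume S: "completion_open X \<epsilon> S" and T: "completion_open X \<epsilon> T"
  let ?L = "topspace (end_space X \<epsilon>)"
  have p: "p0_preimage X \<epsilon> (S \<inter> T) = p0_preimage X \<epsilon> S \<inter> p0_preimage X \<epsilon> T"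
    and i: "in0_preimage X \<epsilon> (S \<inter> T) = in0_preimage X \<epsilon> S \<inter> in0_preimage X \<epsilon> T"
    by (auto simp: p0_preimage_def in0_preimage_def)
  show "completion_open X \<epsilon> (S \<inter> T)"
    unfolding completion_open_def p i
  proof (intro conjI ballI)
    show "S \<inter> T \<subseteq> completion_set X \<epsilon>" using S by (auto simp: completion_open_def)
    show "openin X (p0_preimage X \<epsilon> S \<inter> p0_preimage X \<epsilon> T)"
      using S T by (auto simp: completion_open_def)
    show "openin (end_space X \<epsilon>) (in0_preimage X \<epsilon> S \<inter> in0_preimage X \<epsilon> T)"
      using S T by (auto simp: completion_open_def)
  next
    fix a assume a: "a \<in> in0_preimage X \<epsilon> S \<inter> in0_preimage X \<epsilon> T"
    have aS: "a \<in> in0_preimage X \<epsilon> S" and aT: "a \<in> in0_preimage X \<epsilon> T"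
      using a by auto
    from completion_openE[OF S aS] obtain E1 G1 where 1: "E1 \<in> \<epsilon>"
        "openin (pi0_space (subtopology X E1)) G1"
        "a \<in> {b \<in> ?L. eta0 E1 b \<in> G1}"
        "{b \<in> ?L. eta0 E1 b \<in> G1} \<subseteq> in0_preimage X \<epsilon> S"
        "{x \<in> topspace (subtopology X E1). q0 (subtopology X E1) x \<in> G1} \<subseteq> p0_preimage X \<epsilon> S" .
    from completion_openE[OF T aT] obtain E2 G2 where 2: "E2 \<in> \<epsilon>"
        "openin (pi0_space (subtopology X E2)) G2"
        "a \<in> {b \<in> ?L. eta0 E2 b \<in> G2}"
        "{b \<in> ?L. eta0 E2 b \<in> G2} \<subseteq> in0_preimage X \<epsilon> T"
        "{x \<in> topspace (subtopology X E2). q0 (subtopology X E2) x \<in> G2} \<subseteq> p0_preimage X \<epsilon> T" .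
    define E where "E = E1 \<inter> E2"
    define H where "H F K = {C \<in> path_components_of (subtopology X E).
                                pi0_map (subtopology X F) id C \<in> K}" for F K
    have E: "E \<in> \<epsilon>" "E \<subseteq> E1" "E \<subseteq> E2"
      using 1(1) 2(1) ext unfolding E_def exterior_space_def by blast+
    have H: "openin (pi0_space (subtopology X E)) (H F K)"
      if "E \<subseteq> F" "openin (pi0_space (subtopology X F)) K" for F K
      unfolding H_def
      by (rule openin_pi0_map_preimage[OF continuous_map_subtopology_id[OF that(1)] that(2)])
    have eta: "eta0 E b \<in> H F K \<longleftrightarrow> eta0 F b \<in> K"
      if "b \<in> ?L" "F \<in> \<epsilon>" "E \<subseteq> F" for b F K
      using that E eta0_compat[of b X \<epsilon> F E] eta0_in_path_components[of b X \<epsilon> E]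
      by (auto simp: H_def)
    have q: "q0 (subtopology X E) x \<in> H F K \<longleftrightarrow> q0 (subtopology X F) x \<in> K"
      if "x \<in> topspace (subtopology X E)" "E \<subseteq> F" for x F K
      using q0_subtopology_mono[OF that(2) that(1)] that
      by (auto simp: H_def path_components_of_def)
    show "\<exists>E\<in>\<epsilon>. \<exists>G. openin (pi0_space (subtopology X E)) G \<and>
          a \<in> {b \<in> ?L. eta0 E b \<in> G} \<and>
          {b \<in> ?L. eta0 E b \<in> G} \<subseteq> in0_preimage X \<epsilon> S \<inter> in0_preimage X \<epsilon> T \<and>
          {x \<in> topspace (subtopology X E). q0 (subtopology X E) x \<in> G}
            \<subseteq> p0_preimage X \<epsilon> S \<inter> p0_preimage X \<epsilon> T"
    proof (rule bexI[OF _ E(1)], rule exI[of _ "H E1 G1 \<inter> H E2 G2"], intro conjI)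
      show "openin (pi0_space (subtopology X E)) (H E1 G1 \<inter> H E2 G2)"
        by (intro openin_Int H E 1(2) 2(2))
      show "a \<in> {b \<in> ?L. eta0 E b \<in> H E1 G1 \<inter> H E2 G2}"
        using 1(3) 2(3) eta[OF _ 1(1) E(2)] eta[OF _ 2(1) E(3)] by auto
      show "{b \<in> ?L. eta0 E b \<in> H E1 G1 \<inter> H E2 G2} \<subseteq> in0_preimage X \<epsilon> S \<inter> in0_preimage X \<epsilon> T"
      proof
        fix b assume "b \<in> {b \<in> ?L. eta0 E b \<in> H E1 G1 \<inter> H E2 G2}"
        then have "b \<in> {b \<in> ?L. eta0 E1 b \<in> G1}" "b \<in> {b \<in> ?L. eta0 E2 b \<in> G2}"
          using eta[OF _ 1(1) E(2)] eta[OF _ 2(1) E(3)] by auto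
        then show "b \<in> in0_preimage X \<epsilon> S \<inter> in0_preimage X \<epsilon> T"
          using subsetD[OF 1(4)] subsetD[OF 2(4)] by (intro IntI)
      qed
      have "x \<in> p0_preimage X \<epsilon> S \<inter> p0_preimage X \<epsilon> T"
        if "x \<in> topspace (subtopology X E)"
           "q0 (subtopology X E) x \<in> H E1 G1 \<inter> H E2 G2" for x
      proof -
        have "x \<in> topspace (subtopology X E1)" "x \<in> topspace (subtopology X E2)"
          using that(1) E(2,3) by auto
        moreover have "q0 (subtopology X E1) x \<in> G1" "q0 (subtopology X E2) x \<in> G2"
          using q[OF that(1) E(2)] q[OF that(1) E(3)] that(2) by auto
        ultimately show ?thesis
          by (intro IntI subsetD[OF 1(5)] subsetD[OF 2(5)] CollectI conjI)
      qed
      then show "{x \<in> topspace (subtopology X E). q0 (subtopology X E) x \<in> H E1 G1 \<inter> H E2 G2}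
            \<subseteq> p0_preimage X \<epsilon> S \<inter> p0_preimage X \<epsilon> T" by blast
    qed
  qed
next
  fix \<K> assume K: "\<forall>W\<in>\<K>. completion_open X \<epsilon> W"
  have p: "p0_preimage X \<epsilon> (\<Union>\<K>) = (\<Union>W\<in>\<K>. p0_preimage X \<epsilon> W)"
    and i: "in0_preimage X \<epsilon> (\<Union>\<K>) = (\<Union>W\<in>\<K>. in0_preimage X \<epsilon> W)"
    by (auto simp: p0_preimage_def in0_preimage_def)
  show "completion_open X \<epsilon> (\<Union>\<K>)"
    unfolding completion_open_def p i
  proof (intro conjI ballI)
    show "\<Union>\<K> \<subseteq> completion_set X \<epsilon>" using K by (auto simp: completion_open_def)
    show "openin X (\<Union>W\<in>\<K>. p0_preimage X \<epsilon> W)"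
      using K by (auto simp: completion_open_def)
    show "openin (end_space X \<epsilon>) (\<Union>W\<in>\<K>. in0_preimage X \<epsilon> W)"
      using K by (auto simp: completion_open_def)
  next
    fix a assume "a \<in> (\<Union>W\<in>\<K>. in0_preimage X \<epsilon> W)"
    then obtain W where W: "W \<in> \<K>" "a \<in> in0_preimage X \<epsilon> W" by blast
    from K W(1) have "completion_open X \<epsilon> W" by blast
    from completion_openE[OF this W(2)] obtain E G where EG: "E \<in> \<epsilon>"
        "openin (pi0_space (subtopology X E)) G"
        "a \<in> {b \<in> topspace (end_space X \<epsilon>). eta0 E b \<in> G}"
        "{b \<in> topspace (end_space X \<epsilon>). eta0 E b \<in> G} \<subseteq> in0_preimage X \<epsilon> W"
        "{x \<in> topspace (subtopology X E). q0 (subtopology X E) x \<in> G} \<subseteq> p0_preimage X \<epsilon> W" .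
    have sub: "in0_preimage X \<epsilon> W \<subseteq> (\<Union>W\<in>\<K>. in0_preimage X \<epsilon> W)"
        "p0_preimage X \<epsilon> W \<subseteq> (\<Union>W\<in>\<K>. p0_preimage X \<epsilon> W)"
      using W(1) by auto
    show "\<exists>E\<in>\<epsilon>. \<exists>G. openin (pi0_space (subtopology X E)) G \<and>
          a \<in> {b \<in> topspace (end_space X \<epsilon>). eta0 E b \<in> G} \<and>
          {b \<in> topspace (end_space X \<epsilon>). eta0 E b \<in> G} \<subseteq> (\<Union>W\<in>\<K>. in0_preimage X \<epsilon> W) \<and>
          {x \<in> topspace (subtopology X E). q0 (subtopology X E) x \<in> G}
            \<subseteq> (\<Union>W\<in>\<K>. p0_preimage X \<epsilon> W)"
      by (rule bexI[OF _ EG(1)], rule exI[of _ G], intro conjI)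
         (rule EG(2), rule EG(3), rule subset_trans[OF EG(4) sub(1)], rule subset_trans[OF EG(5) sub(2)])
  qed
qed

lemma openin_completion:
  assumes "exterior_space X \<epsilon>"
  shows "openin (end_completion X \<epsilon>) W \<longleftrightarrow> completion_open X \<epsilon> W"
  using istopology_completion[OF assms] by (simp add: end_completion_def)

lemma p0_in_completion_set: "x \<in> topspace X \<Longrightarrow> p0 X \<epsilon> x \<in> completion_set X \<epsilon>"
  by (auto simp: p0_def completion_set_def intro!: quotientI)

lemma in0_in_completion_set: "a \<in> topspace (end_space X \<epsilon>) \<Longrightarrow> in0 X \<epsilon> a \<in> completion_set X \<epsilon>"
  by (auto simp: in0_def completion_set_def intro!: quotientI)

lemma completion_set_eq:
  "completion_set X \<epsilon> = p0 X \<epsilon> ` topspace X \<union> in0 X \<epsilon> ` topspace (end_space X \<epsilon>)"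
  unfolding completion_set_def quotient_def p0_def in0_def by blast

lemma topspace_completion:
  assumes ext: "exterior_space X \<epsilon>"
  shows "topspace (end_completion X \<epsilon>) = completion_set X \<epsilon>"
proof
  show "topspace (end_completion X \<epsilon>) \<subseteq> completion_set X \<epsilon>"
    using openin_topspace[of "end_completion X \<epsilon>"]
    unfolding openin_completion[OF ext] completion_open_def by (rule conjunct1)
  have p: "p0_preimage X \<epsilon> (completion_set X \<epsilon>) = topspace X"
    and i: "in0_preimage X \<epsilon> (completion_set X \<epsilon>) = topspace (end_space X \<epsilon>)"
    by (auto simp: p0_preimage_def in0_preimage_def p0_in_completion_set in0_in_completion_set)
  obtain E where E: "E \<in> \<epsilon>" using ext by (auto simp: exterior_space_def)
  have "completion_open X \<epsilon> (completion_set X \<epsilon>)"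
    unfolding completion_open_def p i
  proof (intro conjI ballI)
    fix a assume a: "a \<in> topspace (end_space X \<epsilon>)"
    show "\<exists>E\<in>\<epsilon>. \<exists>G. openin (pi0_space (subtopology X E)) G \<and>
          a \<in> {b \<in> topspace (end_space X \<epsilon>). eta0 E b \<in> G} \<and>
          {b \<in> topspace (end_space X \<epsilon>). eta0 E b \<in> G} \<subseteq> topspace (end_space X \<epsilon>) \<and>
          {x \<in> topspace (subtopology X E). q0 (subtopology X E) x \<in> G} \<subseteq> topspace X"
    proof (rule bexI[OF _ E], rule exI[of _ "topspace (pi0_space (subtopology X E))"], intro conjI)
      show "openin (pi0_space (subtopology X E)) (topspace (pi0_space (subtopology X E)))"
        by (rule openin_topspace)
      show "a \<in> {b \<in> topspace (end_space X \<epsilon>). eta0 E b \<in> topspace (pi0_space (subtopology X E))}"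
        using a E eta0_in_path_components by auto
    qed auto
  qed auto
  then show "completion_set X \<epsilon> \<subseteq> topspace (end_completion X \<epsilon>)"
    by (simp add: ext openin_completion openin_subset)
qed

end

theory Submission
  imports Defs
begin

text \<open>Both parts rest on compactness of the end space \<open>lim \<pi>\<^sub>0(E)\<close>. The path-component spaces
  need be neither discrete nor Hausdorff, so the inverse limit cannot be handled by the usual
  theorem on inverse limits of compact Hausdorff spaces. The hypothesis, however, confines the
  \<open>E\<close>-coordinate of every end to a finite set, because it factors through \<open>\<pi>\<^sub>0(E')\<close>. Giving these
  finite sets the discrete topology turns the same set of ends into a closed subset of a compact
  Hausdorff product, and the topology of the end space is coarser than the resulting one
  (\<open>compact_space_end_space\<close>).

  Since \<open>in\<^sub>0\<close> is continuous, part (i) follows once the limit space of the completion is identified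
  with the image of \<open>in\<^sub>0\<close>: a point of \<open>X\<close> outside \<open>L(X)\<close> is glued to nothing, so it leaves
  \<open>W\<^sub>0(E)\<close> as soon as it leaves \<open>E\<close> (\<open>Inter_completion_externology\<close>).

  For part (ii), finitely many members of an open cover of the completion cover the image of
  \<open>in\<^sub>0\<close>; let \<open>W\<close> be their union. By definition, an open set of the completion that contains an end
  contains all path-components of some exterior set that lie in an open set of components around
  that end. Together with compactness of the end space this shows that for a single small \<open>E\<close> the set \<open>W\<close>
  already contains every path-component of \<open>E\<close> that is hit by an end
  (\<open>end_components_subset_neighbourhood\<close>). The points outside these path-components form a compact
  set by hypothesis, and finitely many further members of the cover suffice for its image.\<close>

lemma exterior_lower_bound:
  assumes ext: "exterior_space X \<epsilon>" and "finite \<F>" "\<F> \<subseteq> \<epsilon>"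
  obtains E where "E \<in> \<epsilon>" "\<And>F. F \<in> \<F> \<Longrightarrow> E \<subseteq> F"
proof -
  have "\<exists>E\<in>\<epsilon>. \<forall>F\<in>\<F>. E \<subseteq> F"
    using assms(2,3)
  proof (induction \<F> rule: finite_induct)
    case empty
    from ext have "\<epsilon> \<noteq> {}" unfolding exterior_space_def by (rule conjunct1)
    then show ?case by blast
  next
    case (insert F \<F>)
    then obtain E where "E \<in> \<epsilon>" "\<forall>F\<in>\<F>. E \<subseteq> F" by auto
    moreover have "E \<inter> F \<in> \<epsilon>"
      using ext \<open>E \<in> \<epsilon>\<close> insert.prems unfolding exterior_space_def by blast
    ultimately show ?case by (intro bexI[of _ "E \<inter> F"]) auto
  qed
  then show thesis using that by blast
qed

lemma pi0_map_in_path_components: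
  assumes "continuous_map Y Z f" "C \<in> path_components_of Y"
  shows "pi0_map Z f C \<in> path_components_of Z"
  using assms pi0_map_q0[OF assms(1)]
  by (auto simp: path_components_of_def continuous_map_def)

text \<open>Compatible families need not form a closed set in the product of the spaces \<open>\<pi>\<^sub>0(E)\<close>, where
  points may fail to be separated. They do in the product of the finite sets \<open>F E\<close> below with
  their discrete topologies, and compactness passes from there to the coarser topology of the end
  space.\<close>

lemma compact_space_end_space:
  assumes ext: "exterior_space X \<epsilon>"
    and fin: "\<And>E. E \<in> \<epsilon> \<Longrightarrow> \<exists>E'\<in>\<epsilon>. E' \<subseteq> E \<and>
      finite (pi0_map (subtopology X E) id ` path_components_of (subtopology X E'))"
  shows "compact_space (end_space X \<epsilon>)"
proof -
  obtain N where N: "\<And>E. E \<in> \<epsilon> \<Longrightarrow> N E \<in> \<epsilon>" "\<And>E. E \<in> \<epsilon> \<Longrightarrow> N E \<subseteq> E"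
      "\<And>E. E \<in> \<epsilon> \<Longrightarrow>
        finite (pi0_map (subtopology X E) id ` path_components_of (subtopology X (N E)))"
    using fin by metis
  define F where
    "F E = pi0_map (subtopology X E) id ` path_components_of (subtopology X (N E))" for E
  define P where "P = product_topology (\<lambda>E. discrete_topology (F E)) \<epsilon>"
  define S where "S = {a. \<forall>E\<in>\<epsilon>. \<forall>E'\<in>\<epsilon>. E' \<subseteq> E \<longrightarrow>
    pi0_map (subtopology X E) id (a E') = a E}"
  from ext have nonempty: "\<epsilon> \<noteq> {}"
    unfolding exterior_space_def by (rule conjunct1)
  have topP: "topspace P = (\<Pi>\<^sub>E E\<in>\<epsilon>. F E)"
    by (simp add: P_def)
  have Fsub: "F E \<subseteq> path_components_of (subtopology X E)" if "E \<in> \<epsilon>" for E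
    unfolding F_def
    using pi0_map_in_path_components[OF continuous_map_subtopology_id[OF N(2)[OF that]]] by blast
  have top: "topspace (end_space X \<epsilon>) = topspace P \<inter> S"
  proof
    show "topspace P \<inter> S \<subseteq> topspace (end_space X \<epsilon>)"
      using Fsub by (auto simp: topP S_def end_space_def PiE_iff)
    have "a E \<in> F E" if a: "a \<in> topspace (end_space X \<epsilon>)" and E: "E \<in> \<epsilon>" for a E
    proof -
      have "a E = pi0_map (subtopology X E) id (a (N E))"
        using eta0_compat[OF a E N(1)[OF E] N(2)[OF E]] by (simp add: eta0_def)
      moreover have "a (N E) \<in> path_components_of (subtopology X (N E))"
        using eta0_in_path_components[OF a N(1)[OF E]] by (simp add: eta0_def)
      ultimately show ?thesis by (auto simp: F_def)
    qed
    then show "topspace (end_space X \<epsilon>) \<subseteq> topspace P \<inter> S"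
      by (auto simp: topP S_def end_space_def PiE_iff)
  qed
  \<comment> \<open>Both sides of the compatibility equations are continuous functions of this form into a
    Hausdorff space, so each equation cuts out a closed set.\<close>
  have coord: "continuous_map P (discrete_topology UNIV) (\<lambda>a. h (a E))" if "E \<in> \<epsilon>"
    for E and h :: "'a set \<Rightarrow> 'a set"
  proof -
    have "continuous_map P (discrete_topology (F E)) (\<lambda>a. a E)"
      unfolding P_def by (rule continuous_map_product_projection) (rule that)
    from continuous_map_compose[OF this, of "discrete_topology UNIV" h] show ?thesis
      by (simp add: o_def)
  qed
  have "closedin P (topspace P \<inter> S)"
  proof -
    define I where "I = {(E, E'). E \<in> \<epsilon> \<and> E' \<in> \<epsilon> \<and> E' \<subseteq> E}"
    define K where "K = (\<lambda>(E, E').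
      {a \<in> topspace P. pi0_map (subtopology X E) id (a E') = a E})"
    have "I \<noteq> {}"
      using nonempty by (auto simp: I_def)
    moreover have "closedin P (K i)" if "i \<in> I" for i
      using that coord[where h = "\<lambda>C. C"]
      unfolding I_def K_def by (auto intro!: closedin_continuous_maps_eq[of "discrete_topology UNIV"] coord)
    ultimately have "closedin P (\<Inter>i\<in>I. K i)"
      by blast
    moreover have "(\<Inter>i\<in>I. K i) = topspace P \<inter> S"
      using \<open>I \<noteq> {}\<close> by (fastforce simp: I_def K_def S_def)
    ultimately show ?thesis by simp
  qed
  moreover have "compact_space P"
    using N(3) by (simp add: P_def compact_space_product_topology F_def compact_space_discrete_topology)
  ultimately have "compact_space (subtopology P (topspace P \<inter> S))"
    by (simp add: closedin_compact_space compact_space_subtopology)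
  moreover have "continuous_map (subtopology P (topspace P \<inter> S)) (end_space X \<epsilon>) (\<lambda>a. a)"
  proof -
    have "continuous_map P (product_topology (\<lambda>E. pi0_space (subtopology X E)) \<epsilon>) (\<lambda>a. a)"
      unfolding continuous_map_componentwise
    proof (intro conjI ballI)
      show "(\<lambda>a. a) ` topspace P \<subseteq> extensional \<epsilon>"
        by (auto simp: topP PiE_def)
      fix E assume E: "E \<in> \<epsilon>"
      have "continuous_map P (discrete_topology (F E)) (\<lambda>a. a E)"
        unfolding P_def by (rule continuous_map_product_projection) (rule E)
      moreover have "continuous_map (discrete_topology (F E)) (pi0_space (subtopology X E)) (\<lambda>C. C)"
        using Fsub[OF E] by auto
      ultimately show "continuous_map P (pi0_space (subtopology X E)) (\<lambda>a. a E)"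
        by (rule continuous_map_compose[unfolded o_def])
    qed
    then show ?thesis
      unfolding end_space_def
      by (auto simp: continuous_map_in_subtopology S_def intro: continuous_map_from_subtopology)
  qed
  ultimately have "compactin (end_space X \<epsilon>)
      ((\<lambda>a. a) ` topspace (subtopology P (topspace P \<inter> S)))"
    unfolding compact_space_def by (rule image_compactin)
  then show ?thesis
    by (simp add: compact_space_def top)
qed

lemma continuous_map_p0:
  assumes "exterior_space X \<epsilon>"
  shows "continuous_map X (end_completion X \<epsilon>) (p0 X \<epsilon>)"
  unfolding continuous_map_def
  using assms p0_in_completion_set
  by (auto simp: openin_completion topspace_completion completion_open_def p0_preimage_def)

lemma continuous_map_in0:
  assumes "exterior_space X \<epsilon>"
  shows "continuous_map (end_space X \<epsilon>) (end_completion X \<epsilon>) (in0 X \<epsilon>)"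
  unfolding continuous_map_def
  using assms in0_in_completion_set
  by (auto simp: openin_completion topspace_completion completion_open_def in0_preimage_def)

lemma p0_eq_in0_e0:
  assumes ext: "exterior_space X \<epsilon>" and x: "x \<in> topspace (limit_space X \<epsilon>)"
  shows "p0 X \<epsilon> x = in0 X \<epsilon> (e0 X \<epsilon> x)"
proof -
  have "(Inl x, Inr (e0 X \<epsilon> x)) \<in> completion_rel X \<epsilon>"
    using x e0_in_end_space[OF ext x]
    by (auto simp: completion_rel_def pushout_rel_def limit_space_def intro!: r_into_equivclp)
  then show ?thesis
    unfolding p0_def in0_def
    by (intro equiv_class_eq[of "topspace X <+> topspace (end_space X \<epsilon>)"])
       (simp add: completion_rel_def equiv_pushout_rel)
qed

text \<open>The push-out identifies points only along \<open>L(X)\<close>, so the class of a point outside \<open>L(X)\<close> is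
  a singleton.\<close>

lemma p0_eq_outside_limit:
  assumes x: "x \<in> topspace X" "x \<notin> topspace (limit_space X \<epsilon>)"
    and y: "y \<in> topspace X" and eq: "p0 X \<epsilon> x = p0 X \<epsilon> y"
  shows "x = y"
proof -
  let ?R = "\<lambda>s t. \<exists>z\<in>topspace (limit_space X \<epsilon>). s = Inl z \<and> t = Inr (e0 X \<epsilon> z)"
  have "(Inl y, Inl y) \<in> completion_rel X \<epsilon>"
    using y by (simp add: completion_rel_def pushout_rel_def InlI)
  then have "Inl y \<in> p0 X \<epsilon> x"
    by (simp add: eq) (simp add: p0_def)
  then have "equivclp ?R (Inl x) (Inl y)"
    by (simp add: p0_def completion_rel_def pushout_rel_def)
  moreover have "v = Inl x" if "equivclp ?R (Inl x) v" for v
    using that by (induction rule: equivclp_induct) (use x(2) in auto)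
  ultimately show ?thesis by blast
qed

lemma Inter_completion_externology:
  assumes ext: "exterior_space X \<epsilon>"
  shows "\<Inter>(completion_externology X \<epsilon>) = in0 X \<epsilon> ` topspace (end_space X \<epsilon>)"
proof
  show "in0 X \<epsilon> ` topspace (end_space X \<epsilon>) \<subseteq> \<Inter>(completion_externology X \<epsilon>)"
    by (auto simp: completion_externology_def W0_def)
  have sub: "E \<subseteq> topspace X" if "E \<in> \<epsilon>" for E
    using ext that unfolding exterior_space_def by (blast dest: openin_subset)
  show "\<Inter>(completion_externology X \<epsilon>) \<subseteq> in0 X \<epsilon> ` topspace (end_space X \<epsilon>)"
  proof (rule subsetI, rule ccontr)
    fix w assume w: "w \<in> \<Inter>(completion_externology X \<epsilon>)"
      and nw: "w \<notin> in0 X \<epsilon> ` topspace (end_space X \<epsilon>)"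
    have wE: "w \<in> p0 X \<epsilon> ` E" if "E \<in> \<epsilon>" for E
      using w nw that by (auto simp: completion_externology_def W0_def)
    from ext have "\<epsilon> \<noteq> {}" unfolding exterior_space_def by (rule conjunct1)
    then obtain E where "E \<in> \<epsilon>" by blast
    then obtain x where x: "x \<in> topspace X" "w = p0 X \<epsilon> x"
      using wE sub by blast
    have nL: "x \<notin> topspace (limit_space X \<epsilon>)"
      using p0_eq_in0_e0[OF ext] e0_in_end_space[OF ext] nw x(2) by blast
    have "x \<in> E" if "E \<in> \<epsilon>" for E
      using wE[OF that] x sub[OF that] p0_eq_outside_limit[OF x(1) nL] by blast
    then show False
      using nL x(1) by (simp add: limit_space_def)
  qed
qed

text \<open>The neighbourhoods of the individual ends in \<open>W\<close> are described with exterior sets that vary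
  with the end; compactness leaves finitely many of them, and any exterior set contained in all of
  those serves for every end at once.\<close>

lemma end_components_subset_neighbourhood:
  assumes ext: "exterior_space X \<epsilon>" and comp: "compact_space (end_space X \<epsilon>)"
    and W: "openin (end_completion X \<epsilon>) W" "in0 X \<epsilon> ` topspace (end_space X \<epsilon>) \<subseteq> W"
  obtains E where "E \<in> \<epsilon>" "\<Union>(eta0 E ` topspace (end_space X \<epsilon>)) \<subseteq> p0_preimage X \<epsilon> W"
proof -
  let ?Y = "topspace (end_space X \<epsilon>)"
  define Q where "Q a E G \<longleftrightarrow> E \<in> \<epsilon> \<and> openin (pi0_space (subtopology X E)) G \<and> eta0 E a \<in> G \<and>
    {x \<in> topspace (subtopology X E). q0 (subtopology X E) x \<in> G} \<subseteq> p0_preimage X \<epsilon> W" for a E G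
  have "\<exists>E G. Q a E G" if a: "a \<in> ?Y" for a
  proof -
    have "completion_open X \<epsilon> W" "a \<in> in0_preimage X \<epsilon> W"
      using W a by (auto simp: openin_completion[OF ext] in0_preimage_def)
    then obtain E G where "E \<in> \<epsilon>" "openin (pi0_space (subtopology X E)) G"
        "a \<in> {b \<in> ?Y. eta0 E b \<in> G}"
        "{x \<in> topspace (subtopology X E). q0 (subtopology X E) x \<in> G} \<subseteq> p0_preimage X \<epsilon> W"
      by (rule completion_openE)
    moreover from this(3) have "eta0 E a \<in> G" by simp
    ultimately show ?thesis unfolding Q_def by (intro exI conjI)
  qed
  then obtain e g where Q: "\<And>a. a \<in> ?Y \<Longrightarrow> Q a (e a) (g a)"
    by metis
  have eg: "e a \<in> \<epsilon>" "openin (pi0_space (subtopology X (e a))) (g a)" "eta0 (e a) a \<in> g a"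
      "{x \<in> topspace (subtopology X (e a)). q0 (subtopology X (e a)) x \<in> g a} \<subseteq> p0_preimage X \<epsilon> W"
    if "a \<in> ?Y" for a
    using Q[OF that] unfolding Q_def by simp_all
  define V where "V a = {b \<in> ?Y. eta0 (e a) b \<in> g a}" for a
  have "openin (end_space X \<epsilon>) (V a)" if "a \<in> ?Y" for a
    unfolding V_def
    by (rule openin_continuous_map_preimage[OF continuous_map_eta0[OF eg(1)[OF that]] eg(2)[OF that]])
  moreover have "?Y \<subseteq> \<Union>(V ` ?Y)"
  proof
    fix a assume a: "a \<in> ?Y"
    then have "a \<in> V a" using eg(3) by (simp add: V_def)
    with a show "a \<in> \<Union>(V ` ?Y)" by blast
  qed
  ultimately obtain \<F> where \<F>: "finite \<F>" "\<F> \<subseteq> V ` ?Y" "?Y \<subseteq> \<Union>\<F>"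
    using compactinD[of "end_space X \<epsilon>" ?Y "V ` ?Y"] comp unfolding compact_space_def by blast
  then obtain A where A: "finite A" "A \<subseteq> ?Y" "?Y \<subseteq> \<Union>(V ` A)"
    by (metis finite_subset_image)
  obtain E where E: "E \<in> \<epsilon>" "\<And>F. F \<in> e ` A \<Longrightarrow> E \<subseteq> F"
    using exterior_lower_bound[OF ext, of "e ` A"] A eg(1) by blast
  have "x \<in> p0_preimage X \<epsilon> W" if b: "b \<in> ?Y" and x: "x \<in> eta0 E b" for b x
  proof -
    obtain a where a: "a \<in> A" "b \<in> V a" using A(3) b by blast
    have aY: "a \<in> ?Y" and sub: "E \<subseteq> e a" using a A(2) E(2) by auto
    from eta0_in_path_components[OF b E(1)] obtain z
      where z: "eta0 E b = q0 (subtopology X E) z"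
      by (auto simp: path_components_of_def)
    \<comment> \<open>The coordinate of \<open>b\<close> at \<open>E\<close> is the path-component of \<open>x\<close>; compatibility carries this to the
      larger set \<open>e a\<close>.\<close>
    with x have zx: "path_component_of (subtopology X E) z x" by simp
    then have xE: "x \<in> topspace (subtopology X E)"
      by (meson path_component_in_topspace)
    have "eta0 E b = q0 (subtopology X E) x"
      using z zx by (metis path_component_of_equiv)
    then have "eta0 (e a) b = q0 (subtopology X (e a)) x"
      using eta0_compat[OF b eg(1)[OF aY] E(1) sub] q0_subtopology_mono[OF sub xE] by simp
    moreover have "eta0 (e a) b \<in> g a" using a(2) by (simp add: V_def)
    moreover have "x \<in> topspace (subtopology X (e a))" using xE sub by auto
    ultimately show ?thesis using eg(4)[OF aY] by auto
  qed
  then show thesis using that[OF E(1)] by blast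
qed

theorem theorem3p7:
  fixes X :: "'a topology" and \<epsilon> :: "'a set set"
  assumes "exterior_space X \<epsilon>"
    and "\<forall>E\<in>\<epsilon>. \<exists>E'\<in>\<epsilon>. E' \<subseteq> E \<and>
           finite (pi0_map (subtopology X E) id ` topspace (pi0_space (subtopology X E')))"
  shows "compact_space (limit_space (end_completion X \<epsilon>) (completion_externology X \<epsilon>)) \<and>
    ((\<forall>E\<in>\<epsilon>. compactin X (topspace X - \<Union>(eta0 E ` topspace (end_space X \<epsilon>)))) \<longrightarrow>
       compact_space (end_completion X \<epsilon>))"
proof -
  let ?C = "end_completion X \<epsilon>"
  let ?Y = "topspace (end_space X \<epsilon>)"
  note ext = assms(1)
  have comp: "compact_space (end_space X \<epsilon>)"
    using compact_space_end_space[OF ext] assms(2) by simp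
  then have ends: "compactin ?C (in0 X \<epsilon> ` ?Y)"
    unfolding compact_space_def by (rule image_compactin[OF _ continuous_map_in0[OF ext]])
  show ?thesis
  proof (intro conjI impI)
    show "compact_space (limit_space ?C (completion_externology X \<epsilon>))"
      using ends
      by (simp add: limit_space_def Inter_completion_externology[OF ext] compact_space_subtopology)
  next
    assume rest: "\<forall>E\<in>\<epsilon>. compactin X (topspace X - \<Union>(eta0 E ` ?Y))"
    show "compact_space ?C"
      unfolding compact_space_alt
    proof (intro allI impI)
      fix \<U> assume "(\<forall>U\<in>\<U>. openin ?C U) \<and> topspace ?C \<subseteq> \<Union>\<U>"
      then have \<U>: "\<And>U. U \<in> \<U> \<Longrightarrow> openin ?C U" "topspace ?C \<subseteq> \<Union>\<U>" by auto
      have finite_subcover: "\<exists>\<F>. finite \<F> \<and> \<F> \<subseteq> \<U> \<and> S \<subseteq> \<Union>\<F>" if "compactin ?C S" for S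
        using compactinD[OF that, of \<U>] compactin_subset_topspace[OF that] \<U> by blast
      obtain \<F> where \<F>: "finite \<F>" "\<F> \<subseteq> \<U>" "in0 X \<epsilon> ` ?Y \<subseteq> \<Union>\<F>"
        using finite_subcover[OF ends] by blast
      have "openin ?C (\<Union>\<F>)" using \<F>(2) \<U>(1) by blast
      then obtain E where E: "E \<in> \<epsilon>" "\<Union>(eta0 E ` ?Y) \<subseteq> p0_preimage X \<epsilon> (\<Union>\<F>)"
        using \<F>(3) by (rule end_components_subset_neighbourhood[OF ext comp])
      have "compactin ?C (p0 X \<epsilon> ` (topspace X - \<Union>(eta0 E ` ?Y)))"
        by (rule image_compactin[OF bspec[OF rest E(1)] continuous_map_p0[OF ext]])
      then obtain \<G> where \<G>: "finite \<G>" "\<G> \<subseteq> \<U>"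
          "p0 X \<epsilon> ` (topspace X - \<Union>(eta0 E ` ?Y)) \<subseteq> \<Union>\<G>"
        using finite_subcover[of "p0 X \<epsilon> ` (topspace X - \<Union>(eta0 E ` ?Y))"] by blast
      have "p0 X \<epsilon> ` topspace X \<subseteq> \<Union>(\<F> \<union> \<G>)"
      proof
        fix w assume "w \<in> p0 X \<epsilon> ` topspace X"
        then obtain x where x: "x \<in> topspace X" "w = p0 X \<epsilon> x" by (rule imageE)
        show "w \<in> \<Union>(\<F> \<union> \<G>)"
        proof (cases "x \<in> \<Union>(eta0 E ` ?Y)")
          case True
          then have "x \<in> p0_preimage X \<epsilon> (\<Union>\<F>)" by (rule subsetD[OF E(2)])
          then show ?thesis unfolding p0_preimage_def x(2) by simp
        next
          case False
          then have "p0 X \<epsilon> x \<in> \<Union>\<G>" using x(1) by (intro subsetD[OF \<G>(3)] imageI DiffI)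
          then show ?thesis unfolding x(2) by simp
        qed
      qed
      moreover have "in0 X \<epsilon> ` ?Y \<subseteq> \<Union>(\<F> \<union> \<G>)"
        using \<F>(3) unfolding Union_Un_distrib by (rule le_supI1)
      ultimately have cover: "topspace ?C \<subseteq> \<Union>(\<F> \<union> \<G>)"
        unfolding topspace_completion[OF ext] completion_set_eq by (rule Un_least)
      show "\<exists>\<F>. finite \<F> \<and> \<F> \<subseteq> \<U> \<and> topspace ?C \<subseteq> \<Union>\<F>"
        by (intro exI[of _ "\<F> \<union> \<G>"] conjI finite_UnI Un_least \<F>(1,2) \<G>(1,2) cover)
    qed
  qed
qed

end
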